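(* Let $(W,S)$ be a Coxeter system with identity $e$ and length function $l$, let $q$ be a parameter, let $s_{i_1},\dots,s_{i_n}\in S$ be an arbitrary finite sequence of generators and let $x_1,\dots,x_n$ be arbitrary parameters. With the operators $L_{s,x}$ (acting on the left), $\tilde L_{s,x}$ (acting on the right) and the coefficients $f_n,\tilde f_n,\tilde g_n$ defined in the context, one has for every $\pi\in W$ $$\tilde g_n(e\to\pi)=\tilde f_n(e\to\pi^{-1}).$$ Moreover, if $$L_{s_{i_n},x_n}\cdots L_{s_{i_1},x_1}\,e \;=\; e\,\tilde L_{s_{i_n},x_n}\cdots\tilde L_{s_{i_1},x_1},$$ then for every $\pi\in W$ $$f_n(e\to\pi)=\tilde f_n(e\to\pi^{-1}).$$
   Context: $\mathbb{C}[W]$ denotes the group algebra of $W$. For $s\in S$ and a parameter $x$, $L_{s,x}$ is the linear map on $\mathbb{C}[W]$ with $$L_{s,x}(w)=\begin{cases}(1-x)w+x\,sw,& l(sw)>l(w),\\ (1-qx)w+qx\,sw,& l(sw)<l(w),\end{cases}\qquad w\in W,$$ and $\tilde L_{s,x}$ is the linear map on $\mathbb{C}[W]$, written as acting on the right, with $$w\tilde L_{s,x}=\begin{cases}(1-x)w+x\,ws,& l(ws)>l(w),\\ (1-qx)w+qx\,ws,& l(ws)<l(w),\end{cases}\qquad w\in W.$$ In a product $w\tilde L_{s,x}\tilde L_{s',x'}$ the operator $\tilde L_{s,x}$ is applied first. For the fixed sequences $s_{i_1},\dots,s_{i_n}$ and $x_1,\dots,x_n$, the coefficients are defined by $$L_{s_{i_n},x_n}\cdots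 L_{s_{i_1},x_1}w=\sum_{\pi\in W}f_n(w\to\pi)\,\pi,$$ $$L_{s_{i_1},x_1}\cdots L_{s_{i_n},x_n}w=\sum_{\pi\in W}\tilde f_n(w\to\pi)\,\pi,$$ $$w\,\tilde L_{s_{i_n},x_n}\cdots\tilde L_{s_{i_1},x_1}=\sum_{\pi\in W}\tilde g_n(w\to\pi)\,\pi.$$ *)

theory Defs
  imports "HOL-Algebra.Algebra" "HOL-Library.Poly_Mapping" "HOL-Library.Extended_Nat"
    Complex_Main
begin

section \<open>Group presentations and Coxeter systems\<close>

text \<open>
  A word in the free group on \<open>S\<close> is a list of signed letters: \<open>(a, True)\<close> stands for \<open>a\<close>
  and \<open>(a, False)\<close> for its formal inverse.
\<close>

type_synonym 'a gword = "('a \<times> bool) list"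

definition gwords :: "'a set \<Rightarrow> 'a gword set" where
  "gwords S = {u. fst ` set u \<subseteq> S}"

definition gword_eval :: "('a, 'b) monoid_scheme \<Rightarrow> 'a gword \<Rightarrow> 'a" where
  "gword_eval G u = foldr (\<lambda>(a, b) g. (if b then a else inv\<^bsub>G\<^esub> a) \<otimes>\<^bsub>G\<^esub> g) u \<one>\<^bsub>G\<^esub>"

text \<open>
  Equality of words in the group presented by the generators \<open>S\<close> and the relators \<open>R\<close>.
\<close>

inductive presented_eq :: "'a set \<Rightarrow> 'a gword set \<Rightarrow> 'a gword \<Rightarrow> 'a gword \<Rightarrow> bool"
  for S :: "'a set" and R :: "'a gword set" where
  refl: "u \<in> gwords S \<Longrightarrow> presented_eq S R u u"
| sym: "presented_eq S R u v \<Longrightarrow> presented_eq S R v u"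
| trans: "presented_eq S R u v \<Longrightarrow> presented_eq S R v w \<Longrightarrow> presented_eq S R u w"
| cancel: "u \<in> gwords S \<Longrightarrow> v \<in> gwords S \<Longrightarrow> a \<in> S \<Longrightarrow>
    presented_eq S R (u @ [(a, b), (a, \<not> b)] @ v) (u @ v)"
| relator: "u \<in> gwords S \<Longrightarrow> v \<in> gwords S \<Longrightarrow> r \<in> R \<Longrightarrow> r \<in> gwords S \<Longrightarrow>
    presented_eq S R (u @ r @ v) (u @ v)"

text \<open>
  \<open>G = \<langle>S | R\<rangle>\<close>, where the generators are elements of \<open>G\<close>.
\<close>

definition has_presentation :: "('a, 'b) monoid_scheme \<Rightarrow> 'a set \<Rightarrow> 'a gword set \<Rightarrow> bool" where
  "has_presentation G S R \<longleftrightarrow>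
     S \<subseteq> carrier G \<and> generate G S = carrier G \<and>
     (\<forall>u\<in>gwords S. \<forall>v\<in>gwords S. gword_eval G u = gword_eval G v \<longleftrightarrow> presented_eq S R u v)"

definition coxeter_matrix :: "'a set \<Rightarrow> ('a \<Rightarrow> 'a \<Rightarrow> enat) \<Rightarrow> bool" where
  "coxeter_matrix S m \<longleftrightarrow>
     (\<forall>s\<in>S. \<forall>t\<in>S. 1 \<le> m s t \<and> m s t = m t s \<and> (m s t = 1 \<longleftrightarrow> s = t))"

text \<open>
  The relators \<open>(s t)\<^sup>m\<^sup>(\<^sup>s\<^sup>,\<^sup>t\<^sup>)\<close>; there is none for a pair with \<open>m s t = \<infinity>\<close>.
\<close>

definition coxeter_relators :: "'a set \<Rightarrow> ('a \<Rightarrow> 'a \<Rightarrow> enat) \<Rightarrow> 'a gword set" where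
  "coxeter_relators S m =
     {concat (replicate k [(s, True), (t, True)]) | s t k. s \<in> S \<and> t \<in> S \<and> m s t = enat k}"

locale coxeter_system = group G for G :: "('a, 'b) monoid_scheme" (structure) +
  fixes S :: "'a set"
  assumes presentation: "\<exists>m. coxeter_matrix S m \<and> has_presentation G S (coxeter_relators S m)"

text \<open>
  No inverses are needed here, since the elements of \<open>S\<close> are involutions.
\<close>

definition cox_length :: "('a, 'b) monoid_scheme \<Rightarrow> 'a set \<Rightarrow> 'a \<Rightarrow> nat" where
  "cox_length G S w =
     (LEAST k. \<exists>ss. length ss = k \<and> set ss \<subseteq> S \<and> foldr (\<otimes>\<^bsub>G\<^esub>) ss \<one>\<^bsub>G\<^esub> = w)"


section \<open>The group algebra and the operators on it\<close>

text \<open>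
  An element of \<open>\<complex>[W]\<close> is a finitely supported function \<open>'a \<Rightarrow>\<^sub>0 complex\<close> whose support lies
  in the carrier; the basis vector \<open>w\<close> is \<open>Poly_Mapping.single w 1\<close>. The operators below are
  linear maps on all of \<open>'a \<Rightarrow>\<^sub>0 complex\<close> that leave \<open>\<complex>[W]\<close> invariant.
\<close>

definition group_algebra :: "('a, 'b) monoid_scheme \<Rightarrow> ('a \<Rightarrow>\<^sub>0 complex) set" where
  "group_algebra G = {a. Poly_Mapping.keys a \<subseteq> carrier G}"

abbreviation basis_vec :: "'a \<Rightarrow> 'a \<Rightarrow>\<^sub>0 complex" where
  "basis_vec w \<equiv> Poly_Mapping.single w 1"

definition scale :: "complex \<Rightarrow> ('a \<Rightarrow>\<^sub>0 complex) \<Rightarrow> 'a \<Rightarrow>\<^sub>0 complex" where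
  "scale c a = Poly_Mapping.map ((*) c) a"

definition linear_extension :: "('a \<Rightarrow> 'a \<Rightarrow>\<^sub>0 complex) \<Rightarrow> ('a \<Rightarrow>\<^sub>0 complex) \<Rightarrow> 'a \<Rightarrow>\<^sub>0 complex" where
  "linear_extension \<phi> a =
     (\<Sum>w\<in>Poly_Mapping.keys a. scale (Poly_Mapping.lookup a w) (\<phi> w))"

text \<open>
  For \<open>s \<in> S\<close> the lengths of \<open>w\<close> and \<open>s w\<close> (or \<open>w s\<close>) always differ, so the second branch below
  is the case where the length decreases.
\<close>

definition left_op ::
  "('a, 'b) monoid_scheme \<Rightarrow> 'a set \<Rightarrow> complex \<Rightarrow> 'a \<Rightarrow> complex \<Rightarrow> ('a \<Rightarrow>\<^sub>0 complex) \<Rightarrow> 'a \<Rightarrow>\<^sub>0 complex"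
  where
  "left_op G S q s x = linear_extension (\<lambda>w.
     if cox_length G S (s \<otimes>\<^bsub>G\<^esub> w) > cox_length G S w
     then scale (1 - x) (basis_vec w) + scale x (basis_vec (s \<otimes>\<^bsub>G\<^esub> w))
     else scale (1 - q * x) (basis_vec w) + scale (q * x) (basis_vec (s \<otimes>\<^bsub>G\<^esub> w)))"

definition right_op ::
  "('a, 'b) monoid_scheme \<Rightarrow> 'a set \<Rightarrow> complex \<Rightarrow> 'a \<Rightarrow> complex \<Rightarrow> ('a \<Rightarrow>\<^sub>0 complex) \<Rightarrow> 'a \<Rightarrow>\<^sub>0 complex"
  where
  "right_op G S q s x = linear_extension (\<lambda>w.
     if cox_length G S (w \<otimes>\<^bsub>G\<^esub> s) > cox_length G S w
     then scale (1 - x) (basis_vec w) + scale x (basis_vec (w \<otimes>\<^bsub>G\<^esub> s))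
     else scale (1 - q * x) (basis_vec w) + scale (q * x) (basis_vec (w \<otimes>\<^bsub>G\<^esub> s)))"

text \<open>
  In the operator products the sequences are indexed by \<open>1, \<dots>, n\<close>. Note that \<open>fold\<close> applies
  the operator with index \<open>1\<close> first, and \<open>foldr\<close> the operator with index \<open>n\<close> first:
  \<open>left_product\<close> is \<open>L\<^sub>n \<cdots> L\<^sub>1 a\<close>, \<open>left_product_rev\<close> is \<open>L\<^sub>1 \<cdots> L\<^sub>n a\<close>, and
  \<open>right_product\<close> is \<open>a L\<^sub>n \<cdots> L\<^sub>1\<close> with the operators acting on the right.
\<close>

definition left_product ::
  "('a, 'b) monoid_scheme \<Rightarrow> 'a set \<Rightarrow> complex \<Rightarrow> (nat \<Rightarrow> 'a) \<Rightarrow> (nat \<Rightarrow> complex) \<Rightarrow> nat \<Rightarrow>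
   ('a \<Rightarrow>\<^sub>0 complex) \<Rightarrow> 'a \<Rightarrow>\<^sub>0 complex" where
  "left_product G S q s x n = fold (\<lambda>i. left_op G S q (s i) (x i)) [1..<Suc n]"

definition left_product_rev ::
  "('a, 'b) monoid_scheme \<Rightarrow> 'a set \<Rightarrow> complex \<Rightarrow> (nat \<Rightarrow> 'a) \<Rightarrow> (nat \<Rightarrow> complex) \<Rightarrow> nat \<Rightarrow>
   ('a \<Rightarrow>\<^sub>0 complex) \<Rightarrow> 'a \<Rightarrow>\<^sub>0 complex" where
  "left_product_rev G S q s x n = foldr (\<lambda>i. left_op G S q (s i) (x i)) [1..<Suc n]"

definition right_product ::
  "('a, 'b) monoid_scheme \<Rightarrow> 'a set \<Rightarrow> complex \<Rightarrow> (nat \<Rightarrow> 'a) \<Rightarrow> (nat \<Rightarrow> complex) \<Rightarrow> nat \<Rightarrow>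
   ('a \<Rightarrow>\<^sub>0 complex) \<Rightarrow> 'a \<Rightarrow>\<^sub>0 complex" where
  "right_product G S q s x n = foldr (\<lambda>i. right_op G S q (s i) (x i)) [1..<Suc n]"

text \<open>
  The coefficients \<open>f\<^sub>n(w \<rightarrow> \<pi>)\<close>, and those with a tilde, \<open>f\<^sub>n(w \<rightarrow> \<pi>)\<close> and \<open>g\<^sub>n(w \<rightarrow> \<pi>)\<close>.
\<close>

definition f_coeff ::
  "('a, 'b) monoid_scheme \<Rightarrow> 'a set \<Rightarrow> complex \<Rightarrow> (nat \<Rightarrow> 'a) \<Rightarrow> (nat \<Rightarrow> complex) \<Rightarrow> nat \<Rightarrow>
   'a \<Rightarrow> 'a \<Rightarrow> complex" where
  "f_coeff G S q s x n w \<pi> = Poly_Mapping.lookup (left_product G S q s x n (basis_vec w)) \<pi>"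

definition f_tilde_coeff ::
  "('a, 'b) monoid_scheme \<Rightarrow> 'a set \<Rightarrow> complex \<Rightarrow> (nat \<Rightarrow> 'a) \<Rightarrow> (nat \<Rightarrow> complex) \<Rightarrow> nat \<Rightarrow>
   'a \<Rightarrow> 'a \<Rightarrow> complex" where
  "f_tilde_coeff G S q s x n w \<pi> =
     Poly_Mapping.lookup (left_product_rev G S q s x n (basis_vec w)) \<pi>"

definition g_tilde_coeff ::
  "('a, 'b) monoid_scheme \<Rightarrow> 'a set \<Rightarrow> complex \<Rightarrow> (nat \<Rightarrow> 'a) \<Rightarrow> (nat \<Rightarrow> complex) \<Rightarrow> nat \<Rightarrow>
   'a \<Rightarrow> 'a \<Rightarrow> complex" where
  "g_tilde_coeff G S q s x n w \<pi> =
     Poly_Mapping.lookup (right_product G S q s x n (basis_vec w)) \<pi>"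


subsection \<open>Linearity and invariance\<close>

lemma lookup_scale [simp]:
  "Poly_Mapping.lookup (scale c a) w = c * Poly_Mapping.lookup a w"
  by (simp add: scale_def Poly_Mapping.map.rep_eq when_def)

lemma linear_extension_superset:
  assumes "finite A" "Poly_Mapping.keys a \<subseteq> A"
  shows "linear_extension \<phi> a = (\<Sum>w\<in>A. scale (Poly_Mapping.lookup a w) (\<phi> w))"
  unfolding linear_extension_def
  by (rule sum.mono_neutral_left)
     (use assms in \<open>auto simp: in_keys_iff intro!: poly_mapping_eqI\<close>)

lemma linear_extension_basis [simp]: "linear_extension \<phi> (basis_vec w) = \<phi> w"
  by (rule poly_mapping_eqI) (simp add: linear_extension_def)

lemma linear_extension_add:
  "linear_extension \<phi> (a + b) = linear_extension \<phi> a + linear_extension \<phi> b"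
proof -
  let ?A = "Poly_Mapping.keys a \<union> Poly_Mapping.keys b"
  have "Poly_Mapping.keys (a + b) \<subseteq> ?A" by (rule keys_add)
  then show ?thesis
    by (intro poly_mapping_eqI)
       (simp add: linear_extension_superset[of ?A] lookup_sum lookup_add algebra_simps sum.distrib)
qed

lemma linear_extension_scale:
  "linear_extension \<phi> (scale c a) = scale c (linear_extension \<phi> a)"
proof -
  have "Poly_Mapping.keys (scale c a) \<subseteq> Poly_Mapping.keys a"
    by (auto simp: in_keys_iff)
  then show ?thesis
    by (intro poly_mapping_eqI)
       (simp add: linear_extension_superset[of "Poly_Mapping.keys a"] lookup_sum
          sum_distrib_left mult.assoc)
qed

lemma linear_extension_group_algebra:
  assumes "\<And>w. w \<in> carrier G \<Longrightarrow> \<phi> w \<in> group_algebra G" and "a \<in> group_algebra G"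
  shows "linear_extension \<phi> a \<in> group_algebra G"
proof -
  have "Poly_Mapping.lookup (linear_extension \<phi> a) v = 0" if "v \<notin> carrier G" for v
  proof -
    have "Poly_Mapping.lookup (\<phi> w) v = 0" if "w \<in> Poly_Mapping.keys a" for w
    proof -
      have "\<phi> w \<in> group_algebra G"
        using assms that by (auto simp: group_algebra_def)
      then show ?thesis
        using \<open>v \<notin> carrier G\<close> by (auto simp: group_algebra_def in_keys_iff)
    qed
    then show ?thesis by (simp add: linear_extension_def lookup_sum)
  qed
  then show ?thesis by (auto simp: group_algebra_def in_keys_iff)
qed

lemma (in group) left_op_group_algebra:
  assumes "s \<in> carrier G" "a \<in> group_algebra G"
  shows "left_op G S q s x a \<in> group_algebra G"
  unfolding left_op_def using assms
  by (intro linear_extension_group_algebra)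
     (auto simp: group_algebra_def in_keys_iff lookup_add lookup_single when_def split: if_splits)

lemma (in group) right_op_group_algebra:
  assumes "s \<in> carrier G" "a \<in> group_algebra G"
  shows "right_op G S q s x a \<in> group_algebra G"
  unfolding right_op_def using assms
  by (intro linear_extension_group_algebra)
     (auto simp: group_algebra_def in_keys_iff lookup_add lookup_single when_def split: if_splits)

end

theory Submission
  imports Defs
begin

text \<open>
  Generators are involutions, so reversing a word inverts the element it represents; hence \<open>w\<close>
  and \<open>w\<inverse>\<close> have equal length. The linear extension of inversion therefore intertwines
  \<open>L\<^sub>s\<^sub>,\<^sub>x\<close> with its right-handed counterpart, and it fixes \<open>e\<close>.
\<close>

lemma linear_extension_cong:
  assumes "\<And>w. w \<in> Poly_Mapping.keys a \<Longrightarrow> \<phi> w = \<psi> w"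
  shows "linear_extension \<phi> a = linear_extension \<psi> a"
  unfolding linear_extension_def using assms by (intro sum.cong) auto

lemma linear_extension_sum:
  assumes "finite A"
  shows "linear_extension \<phi> (\<Sum>i\<in>A. f i) = (\<Sum>i\<in>A. linear_extension \<phi> (f i))"
  using assms
proof (induction A)
  case empty
  show ?case by (simp add: linear_extension_def)
next
  case (insert i A)
  then show ?case by (simp add: linear_extension_add)
qed

text \<open>Collapses a composite into a single linear extension, so that two composites can be
  compared on basis vectors with \<open>linear_extension_cong\<close>.\<close>

lemma linear_extension_comp:
  "linear_extension \<phi> (linear_extension \<psi> a) = linear_extension (\<lambda>w. linear_extension \<phi> (\<psi> w)) a"
  by (simp add: linear_extension_def[of \<psi>] linear_extension_def[of "\<lambda>w. linear_extension \<phi> (\<psi> w)"]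
      linear_extension_sum linear_extension_scale)

text \<open>On \<open>group_algebra G\<close> this is the antipode, an anti-automorphism that
  exchanges left and right multiplication by a group element and its inverse.\<close>

definition inversion :: "('a, 'b) monoid_scheme \<Rightarrow> ('a \<Rightarrow>\<^sub>0 complex) \<Rightarrow> 'a \<Rightarrow>\<^sub>0 complex" where
  "inversion G = linear_extension (\<lambda>w. basis_vec (inv\<^bsub>G\<^esub> w))"

lemma (in group) lookup_inversion:
  assumes "a \<in> group_algebra G" "\<pi> \<in> carrier G"
  shows "Poly_Mapping.lookup (inversion G a) \<pi> = Poly_Mapping.lookup a (inv \<pi>)"
proof -
  \<comment> \<open>Inversion is an involution on the carrier, which contains the support of
    \<open>a\<close>; hence only the term at \<open>inv \<pi>\<close> survives in the sum.\<close>
  have "inv w = \<pi> \<longleftrightarrow> w = inv \<pi>" if "w \<in> Poly_Mapping.keys a" for w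
    using assms that by (auto simp: group_algebra_def)
  then have "Poly_Mapping.lookup (inversion G a) \<pi>
      = (\<Sum>w\<in>Poly_Mapping.keys a. if w = inv \<pi> then Poly_Mapping.lookup a w else 0)"
    unfolding inversion_def linear_extension_def lookup_sum
    by (intro sum.cong) (auto simp: lookup_single when_def)
  also have "\<dots> = Poly_Mapping.lookup a (inv \<pi>)"
    by (simp add: in_keys_iff)
  finally show ?thesis .
qed

context coxeter_system
begin

lemma generators_subset: "S \<subseteq> carrier G"
  using presentation by (auto simp: has_presentation_def)

lemma generator_involution:
  assumes "t \<in> S"
  shows "t \<otimes> t = \<one>"
proof -
  obtain m where m: "coxeter_matrix S m" "has_presentation G S (coxeter_relators S m)"
    using presentation by blast
  let ?r = "[(t, True), (t, True)]"
  have "m t t = enat 1"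
    using m(1) assms by (simp add: coxeter_matrix_def one_enat_def)
  \<comment> \<open>The diagonal entry 1 of the Coxeter matrix gives the relator
    \<open>(t t)^1\<close>; the trivial \<open>replicate 1\<close> matches the shape of
    \<open>coxeter_relators\<close> with \<open>k = 1\<close>.\<close>
  then have "concat (replicate 1 ?r) \<in> coxeter_relators S m"
    unfolding coxeter_relators_def using assms by blast
  then have "?r \<in> coxeter_relators S m" by simp
  moreover have words: "[] \<in> gwords S" "?r \<in> gwords S"
    using assms by (auto simp: gwords_def)
  ultimately have "presented_eq S (coxeter_relators S m) ?r []"
    using presented_eq.relator[of "[]" S "[]" ?r "coxeter_relators S m"] by simp
  then have "gword_eval G ?r = gword_eval G []"
    using m(2) words unfolding has_presentation_def by blast
  then show ?thesis
    using assms generators_subset by (auto simp: gword_eval_def)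
qed

lemma inv_generator: "t \<in> S \<Longrightarrow> inv t = t"
  using generator_involution generators_subset by (intro inv_equality) auto

lemma word_closed: "set ss \<subseteq> S \<Longrightarrow> foldr (\<otimes>) ss \<one> \<in> carrier G"
  using generators_subset by (induction ss) auto

lemma word_snoc:
  assumes "set ss \<subseteq> S" "t \<in> S"
  shows "foldr (\<otimes>) (ss @ [t]) \<one> = foldr (\<otimes>) ss \<one> \<otimes> t"
  using assms(1)
proof (induction ss)
  case Nil
  then show ?case using assms(2) generators_subset by auto
next
  case (Cons u ss)
  moreover have "u \<in> carrier G" "t \<in> carrier G"
    using Cons.prems assms(2) generators_subset by auto
  ultimately show ?case using word_closed[of ss] by (simp add: m_assoc)
qed

lemma word_rev: "set ss \<subseteq> S \<Longrightarrow> foldr (\<otimes>) (rev ss) \<one> = inv (foldr (\<otimes>) ss \<one>)"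
proof (induction ss)
  case Nil
  then show ?case by simp
next
  case (Cons u ss)
  moreover have "u \<in> carrier G" using Cons.prems generators_subset by auto
  ultimately show ?case
    using word_closed[of ss] word_snoc[of "rev ss" u] by (simp add: inv_mult_group inv_generator)
qed

lemma cox_length_inv:
  assumes "w \<in> carrier G"
  shows "cox_length G S (inv w) = cox_length G S w"
proof -
  \<comment> \<open>Reversal turns a word for \<open>v\<close> into one of the same length for
    \<open>inv v\<close>. Taking \<open>v\<close> to be \<open>w\<close> and then
    \<open>inv w\<close> gives both directions of the equivalence below, so the two
    \<open>LEAST\<close> predicates coincide.\<close>
  have inv_word: "\<exists>ss. length ss = k \<and> set ss \<subseteq> S \<and> foldr (\<otimes>) ss \<one> = inv v"
    if "\<exists>ss. length ss = k \<and> set ss \<subseteq> S \<and> foldr (\<otimes>) ss \<one> = v" for k v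
    using that word_rev by (metis length_rev set_rev)
  have "(\<exists>ss. length ss = k \<and> set ss \<subseteq> S \<and> foldr (\<otimes>) ss \<one> = inv w)
      \<longleftrightarrow> (\<exists>ss. length ss = k \<and> set ss \<subseteq> S \<and> foldr (\<otimes>) ss \<one> = w)" for k
    using inv_word[of k w] inv_word[of k "inv w"] assms by auto
  then show ?thesis by (simp add: cox_length_def)
qed

text \<open>On a basis vector \<open>w\<close>, inversion sends \<open>t \<otimes> w\<close> to
  \<open>inv w \<otimes> t\<close>, and its invariance under inversion makes the length comparison
  select the same branch on both sides.\<close>

lemma inversion_left_op:
  assumes "t \<in> S" "a \<in> group_algebra G"
  shows "inversion G (left_op G S q t x a) = right_op G S q t x (inversion G a)"
  unfolding inversion_def left_op_def right_op_def linear_extension_comp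
\<comment> \<open>Both sides are now linear extensions applied to the same \<open>a\<close>, so it
  suffices to compare them on its support, where the group laws are available.\<close>
proof (rule linear_extension_cong)
  fix w assume "w \<in> Poly_Mapping.keys a"
  then have w: "w \<in> carrier G" using assms by (auto simp: group_algebra_def)
  have t: "t \<in> carrier G" using assms generators_subset by auto
  have mult: "inv w \<otimes> t = inv (t \<otimes> w)"
    using w t assms by (simp add: inv_mult_group inv_generator)
  show "linear_extension (\<lambda>w. basis_vec (inv w))
      (if cox_length G S w < cox_length G S (t \<otimes> w)
       then scale (1 - x) (basis_vec w) + scale x (basis_vec (t \<otimes> w))
       else scale (1 - q * x) (basis_vec w) + scale (q * x) (basis_vec (t \<otimes> w))) =
    linear_extension
      (\<lambda>w. if cox_length G S w < cox_length G S (w \<otimes> t)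
       then scale (1 - x) (basis_vec w) + scale x (basis_vec (w \<otimes> t))
       else scale (1 - q * x) (basis_vec w) + scale (q * x) (basis_vec (w \<otimes> t)))
      (basis_vec (inv w))"
    using w t by (simp add: mult cox_length_inv linear_extension_add linear_extension_scale)
qed

lemma foldr_left_op_group_algebra:
  assumes "\<And>i. i \<in> set is \<Longrightarrow> s i \<in> S" "a \<in> group_algebra G"
  shows "foldr (\<lambda>i. left_op G S q (s i) (x i)) is a \<in> group_algebra G"
  using assms generators_subset by (induction "is") (auto intro!: left_op_group_algebra)

text \<open>Inversion moves past one operator at a time, each partial product staying in the group
  algebra. Both folds apply the last index first: this is why \<open>right_product\<close> is
  matched with \<open>left_product_rev\<close> and not with \<open>left_product\<close>.\<close>

lemma inversion_foldr_left_op: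
  assumes "\<And>i. i \<in> set is \<Longrightarrow> s i \<in> S" "a \<in> group_algebra G"
  shows "inversion G (foldr (\<lambda>i. left_op G S q (s i) (x i)) is a)
    = foldr (\<lambda>i. right_op G S q (s i) (x i)) is (inversion G a)"
  using assms by (induction "is") (simp_all add: inversion_left_op foldr_left_op_group_algebra)

end

theorem theorem3p4:
  fixes G :: "('a, 'b) monoid_scheme" (structure)
    and S :: "'a set" and q :: complex
    and n :: nat and s :: "nat \<Rightarrow> 'a" and x :: "nat \<Rightarrow> complex"
  assumes "coxeter_system G S"
    and "\<And>i. i \<in> {1..n} \<Longrightarrow> s i \<in> S"
  shows "(\<forall>\<pi>\<in>carrier G. g_tilde_coeff G S q s x n \<one> \<pi> = f_tilde_coeff G S q s x n \<one> (inv \<pi>))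
    \<and> (left_product G S q s x n (basis_vec \<one>) = right_product G S q s x n (basis_vec \<one>)
       \<longrightarrow> (\<forall>\<pi>\<in>carrier G. f_coeff G S q s x n \<one> \<pi> = f_tilde_coeff G S q s x n \<one> (inv \<pi>)))"
proof -
  interpret coxeter_system G S by fact
  have gen: "s i \<in> S" if "i \<in> set [1..<Suc n]" for i
    using that by (intro assms(2)) auto
  have one: "basis_vec \<one> \<in> group_algebra G" by (simp add: group_algebra_def)
  have "inversion G (basis_vec \<one>) = basis_vec \<one>" by (simp add: inversion_def)
  then have "right_product G S q s x n (basis_vec \<one>)
      = inversion G (left_product_rev G S q s x n (basis_vec \<one>))"
    unfolding right_product_def left_product_rev_def
    using inversion_foldr_left_op[where s = s and x = x and q = q, OF gen one] by metis
  moreover have "left_product_rev G S q s x n (basis_vec \<one>) \<in> group_algebra G"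
    unfolding left_product_rev_def using gen one by (rule foldr_left_op_group_algebra)
  ultimately have g: "g_tilde_coeff G S q s x n \<one> \<pi> = f_tilde_coeff G S q s x n \<one> (inv \<pi>)"
    if "\<pi> \<in> carrier G" for \<pi>
    using that by (simp add: g_tilde_coeff_def f_tilde_coeff_def lookup_inversion)
  \<comment> \<open>Under the hypothesis of the second claim, \<open>f_coeff\<close> and
    \<open>g_tilde_coeff\<close> at the identity are coefficients of the same vector, so
    \<open>g\<close> applies again.\<close>
  then show ?thesis by (auto simp: f_coeff_def g_tilde_coeff_def)
qed

end
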